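(* Let $\mathcal{M}$ and $\mathcal{M}^{\rm r}$ be probability measures on a measurable space $(X,\mathcal{X})$ of paths in which singletons are measurable, and suppose that $\mathcal{M}$ is continuous, i.e. $\mathcal{M}(\{\omega\})=0$ for every $\omega\in X$. Let $\mathcal{M}^{\rm r}=\mathcal{M}^{\rm r}_{\rm ac}+\mathcal{M}^{\rm r}_{\rm sc}+\mathcal{M}^{\rm r}_{\rm d}$ be the decomposition of $\mathcal{M}^{\rm r}$ into its absolutely continuous, singular continuous and discrete parts with respect to $\mathcal{M}$, let $\sigma$ be defined by $e^{-\sigma}=d\mathcal{M}^{\rm r}_{\rm ac}/d\mathcal{M}$, and put $\lambda_{\rm sc}=\mathcal{M}^{\rm r}_{\rm sc}(X)$, $\lambda_{\rm d}=\mathcal{M}^{\rm r}_{\rm d}(X)$. Then for every measurable functional $\mathcal{F}:X\to\mathbb{R}$ integrable with respect to $\mathcal{M}^{\rm r}$, $$\langle\mathcal{F}e^{-\sigma}\rangle=\langle\mathcal{F}\rangle^{\rm r}-\langle\mathcal{F}\rangle^{\rm r}_{\rm sc}-\langle\mathcal{F}\rangle^{\rm r}_{\rm d}.$$ In particular, $$\langle e^{-\sigma}\rangle=1-\lambda_{\rm sc}-\lambda_{\rm d},\qquad \langle\sigma\rangle\ge-\ln(1-\lambda_{\rm sc}-\lambda_{\rm d}).$$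
   Context: A point $\omega$ is a discontinuous point of a measure $\nu$ if $\nu(\{\omega\})>0$; $\nu$ is continuous if it has no discontinuous points, and discrete if $\nu(X)=\nu(C)$, where $C$ is the set of its discontinuous points. Since $\mathcal{M}$ is continuous, $\mathcal{M}^{\rm r}$ decomposes uniquely as $\mathcal{M}^{\rm r}_{\rm ac}+\mathcal{M}^{\rm r}_{\rm sc}+\mathcal{M}^{\rm r}_{\rm d}$ with $\mathcal{M}^{\rm r}_{\rm ac}\ll\mathcal{M}$, with $\mathcal{M}^{\rm r}_{\rm sc}\perp\mathcal{M}$ and $\mathcal{M}^{\rm r}_{\rm sc}$ continuous, and with $\mathcal{M}^{\rm r}_{\rm d}$ discrete. The quantity $\sigma$ (entropy production) is defined $\mathcal{M}$-almost everywhere with values in $(-\infty,+\infty]$ ($e^{-\infty}=0$). The notations $\langle\cdot\rangle$, $\langle\cdot\rangle^{\rm r}$, $\langle\cdot\rangle^{\rm r}_{\rm sc}$, $\langle\cdot\rangle^{\rm r}_{\rm d}$ denote integration against $\mathcal{M}$, $\mathcal{M}^{\rm r}$, $\mathcal{M}^{\rm r}_{\rm sc}$, $\mathcal{M}^{\rm r}_{\rm d}$. Convention: $-\ln0=+\infty$, and $\langle\sigma\rangle\in(-\infty,+\infty]$. *)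

theory Defs
  imports "HOL-Probability.Probability"
begin

definition discontinuity_points :: "'a measure \<Rightarrow> 'a set" where
  "discontinuity_points \<nu> = {\<omega> \<in> space \<nu>. emeasure \<nu> {\<omega>} > 0}"

definition continuous_measure :: "'a measure \<Rightarrow> bool" where
  "continuous_measure \<nu> \<longleftrightarrow> discontinuity_points \<nu> = {}"

(* When \<nu> is finite and singletons are measurable, discontinuity_points \<nu> is countable,
   hence measurable. *)
definition discrete_measure :: "'a measure \<Rightarrow> bool" where
  "discrete_measure \<nu> \<longleftrightarrow> emeasure \<nu> (space \<nu>) = emeasure \<nu> (discontinuity_points \<nu>)"

definition mutually_singular :: "'a measure \<Rightarrow> 'a measure \<Rightarrow> bool" where
  "mutually_singular M N \<longleftrightarrow>
     (\<exists>A \<in> sets M \<inter> sets N. emeasure N A = 0 \<and> emeasure M (space M - A) = 0)"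

(* N = Nac + Nsc + Nd as measures; absolutely_continuous M Nac is Nac << M. *)
definition lebesgue_decomposition ::
  "'a measure \<Rightarrow> 'a measure \<Rightarrow> 'a measure \<Rightarrow> 'a measure \<Rightarrow> 'a measure \<Rightarrow> bool" where
  "lebesgue_decomposition M N Nac Nsc Nd \<longleftrightarrow>
     sets Nac = sets M \<and> sets Nsc = sets M \<and> sets Nd = sets M \<and>
     (\<forall>A \<in> sets M. emeasure N A = emeasure Nac A + emeasure Nsc A + emeasure Nd A) \<and>
     absolutely_continuous M Nac \<and>
     mutually_singular M Nsc \<and> continuous_measure Nsc \<and>
     discrete_measure Nd"

definition exp_ereal :: "ereal \<Rightarrow> ennreal" where
  "exp_ereal x = (if x = \<infinity> then \<infinity> else if x = -\<infinity> then 0 else ennreal (exp (real_of_ereal x)))"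

(* The library has ln 0 = 0. Only arguments in [0, 1] matter below. *)
definition ln_ereal :: "real \<Rightarrow> ereal" where
  "ln_ereal x = (if x = 0 then -\<infinity> else ereal (ln x))"

(* exp (- \<sigma>) = dNac/dM, an identity M-almost everywhere. *)
definition entropy_production :: "'a measure \<Rightarrow> 'a measure \<Rightarrow> ('a \<Rightarrow> ereal) \<Rightarrow> bool" where
  "entropy_production M Nac \<sigma> \<longleftrightarrow>
     \<sigma> \<in> borel_measurable M \<and>
     (AE \<omega> in M. \<sigma> \<omega> \<noteq> -\<infinity>) \<and>
     (AE \<omega> in M. exp_ereal (- \<sigma> \<omega>) = RN_deriv M Nac \<omega>)"

(* e2ennreal truncates negative values to 0, so these are the integrals of the positive and
   negative parts of f. *)
definition pos_integral :: "'a measure \<Rightarrow> ('a \<Rightarrow> ereal) \<Rightarrow> ennreal" where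
  "pos_integral M f = (\<integral>\<^sup>+ \<omega>. e2ennreal (f \<omega>) \<partial>M)"

definition neg_integral :: "'a measure \<Rightarrow> ('a \<Rightarrow> ereal) \<Rightarrow> ennreal" where
  "neg_integral M f = (\<integral>\<^sup>+ \<omega>. e2ennreal (- f \<omega>) \<partial>M)"

(* Meaningful only if one of the two parts is finite: ereal has \<infinity> - \<infinity> = \<infinity>. *)
definition ereal_integral :: "'a measure \<Rightarrow> ('a \<Rightarrow> ereal) \<Rightarrow> ereal" where
  "ereal_integral M f = enn2ereal (pos_integral M f) - enn2ereal (neg_integral M f)"

end

theory Submission
  imports Defs
begin

text \<open>Since \<open>e^{-\<sigma>}\<close> is a density of the absolutely continuous part, the identity is the
  additivity of the integral in the measure. The inequality is Jensen's: with
  \<open>c = \<langle>e^{-\<sigma>}\<rangle> > 0\<close>, integrate \<open>e^{-\<sigma> - ln c} \<ge> 1 - \<sigma> - ln c\<close>.\<close>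

text \<open>Induction over the construction of \<open>f\<close> from indicators by scaling, sums and
  increasing limits. For indicators the claim is \<open>sum\<close>. The later cases use rules for
  the integral that hold for any measure \<open>K\<close> with the sets of \<open>N\<close>, so that
  they apply to \<open>N\<close>, \<open>A\<close>, \<open>B\<close> and \<open>C\<close>
  alike.\<close>

lemma nn_integral_measure_add3:
  assumes sets: "sets A = sets N" "sets B = sets N" "sets C = sets N"
    and sum: "\<forall>X \<in> sets N. emeasure N X = emeasure A X + emeasure B X + emeasure C X"
    and f: "f \<in> borel_measurable N"
  shows "nn_integral N f = nn_integral A f + nn_integral B f + nn_integral C f"
  using f
proof (induction rule: borel_measurable_induct)
  case (cong f g)
  moreover have "nn_integral K f = nn_integral K g" if "sets K = sets N" for K
    using cong(3) sets_eq_imp_space_eq[OF that] by (intro nn_integral_cong) auto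
  ultimately show ?case using sets by simp
next
  case (set X)
  then show ?case using sets sum by simp
next
  case (mult u c)
  moreover have "nn_integral K (\<lambda>x. c * u x) = c * nn_integral K u" if "sets K = sets N" for K
    using mult(2) that by (intro nn_integral_cmult) (simp cong: measurable_cong_sets)
  ultimately show ?case using sets by (simp add: distrib_left)
next
  case (add u v)
  moreover have "nn_integral K (\<lambda>x. v x + u x) = nn_integral K v + nn_integral K u"
    if "sets K = sets N" for K
    using add(1,3) that by (intro nn_integral_add) (simp_all cong: measurable_cong_sets)
  ultimately show ?case using sets by (simp add: ac_simps)
next
  case (seq U)
  have S: "nn_integral K (SUP i. U i) = (SUP i. nn_integral K (U i))" if "sets K = sets N" for K
    unfolding SUP_apply using seq(1,3) that
    by (intro nn_integral_monotone_convergence_SUP) (simp_all cong: measurable_cong_sets)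
  have I: "incseq (\<lambda>i. nn_integral K (U i))" for K
    using seq(3) by (auto simp: incseq_def le_fun_def intro!: nn_integral_mono)
  \<comment> \<open>Supremum and sum commute because all the sequences increase. The rule handles
    two summands, hence the two rounds.\<close>
  have "(SUP i. nn_integral A (U i) + nn_integral B (U i) + nn_integral C (U i))
      = (SUP i. nn_integral A (U i) + nn_integral B (U i)) + (SUP i. nn_integral C (U i))"
    by (intro ennreal_SUP_add I)
      (use I in \<open>auto simp: incseq_def intro!: add_mono\<close>)
  also have "(SUP i. nn_integral A (U i) + nn_integral B (U i))
      = (SUP i. nn_integral A (U i)) + (SUP i. nn_integral B (U i))"
    by (intro ennreal_SUP_add I)
  finally show ?case
    by (simp only: seq(4) S[OF refl] S[OF sets(1)] S[OF sets(2)] S[OF sets(3)] seq.IH)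
qed

text \<open>The nonnegative case is applied to \<open>\<bar>f\<bar>\<close> for integrability, since
  each of the three summands is bounded by a finite total, and to \<open>f\<close> and
  \<open>- f\<close> for the value.\<close>

lemma integral_measure_add3:
  fixes f :: "'a \<Rightarrow> real"
  assumes sets: "sets A = sets N" "sets B = sets N" "sets C = sets N"
    and sum: "\<forall>X \<in> sets N. emeasure N X = emeasure A X + emeasure B X + emeasure C X"
    and f: "integrable N f"
  shows "integrable A f" "integrable B f" "integrable C f"
    and "integral\<^sup>L N f = integral\<^sup>L A f + integral\<^sup>L B f + integral\<^sup>L C f"
proof -
  note [measurable] = borel_measurable_integrable[OF f]
  have m: "f \<in> borel_measurable A" "f \<in> borel_measurable B" "f \<in> borel_measurable C"
    using sets by (simp_all cong: measurable_cong_sets)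
  have split: "(\<integral>\<^sup>+x. ennreal (g x) \<partial>N)
      = (\<integral>\<^sup>+x. ennreal (g x) \<partial>A) + (\<integral>\<^sup>+x. ennreal (g x) \<partial>B) + (\<integral>\<^sup>+x. ennreal (g x) \<partial>C)"
    if [measurable]: "g \<in> borel_measurable N" for g :: "'a \<Rightarrow> real"
    using sets sum by (intro nn_integral_measure_add3) auto
  have "(\<integral>\<^sup>+x. ennreal \<bar>f x\<bar> \<partial>N) < \<infinity>"
    using f by (simp add: integrable_iff_bounded)
  then show int: "integrable A f" "integrable B f" "integrable C f"
    using m by (simp_all add: integrable_iff_bounded split)
  \<comment> \<open>\<open>enn2real\<close> is additive only on finite values, since it sends
    infinity to 0.\<close>
  have fin: "(\<integral>\<^sup>+x. ennreal (f x) \<partial>K) < \<infinity>" "(\<integral>\<^sup>+x. ennreal (- f x) \<partial>K) < \<infinity>"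
    if "integrable K f" for K
    using that unfolding real_integrable_def by (simp_all add: top.not_eq_extremum)
  show "integral\<^sup>L N f = integral\<^sup>L A f + integral\<^sup>L B f + integral\<^sup>L C f"
    using int f fin[OF int(1)] fin[OF int(2)] fin[OF int(3)]
    by (simp add: real_lebesgue_integral_def split enn2real_plus)
qed

lemma exp_ereal_measurable [measurable]: "exp_ereal \<in> borel_measurable borel"
  unfolding exp_ereal_def[abs_def] by measurable

text \<open>From \<open>r \<le> exp r\<close>; at both infinities the two sides agree. With
  \<open>- \<sigma>\<close> for \<open>x\<close> this dominates the negative part of
  \<open>\<sigma>\<close> by the density.\<close>

lemma e2ennreal_le_exp_ereal: "e2ennreal x \<le> exp_ereal x"
proof (cases x)
  case (real r)
  have "r \<le> exp r"
    using exp_ge_add_one_self[of r] by linarith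
  then show ?thesis
    using real by (simp add: exp_ereal_def ennreal_leI)
qed (auto simp: exp_ereal_def e2ennreal_neg)

text \<open>A finite integral of the positive part excludes the value \<open>\<infinity>\<close>
  almost everywhere, one of the negative part excludes \<open>-\<infinity>\<close>. This passes from
  extended-valued functions to real ones, where Jensen's inequality is available.\<close>

lemma ereal_integral_eq_integral:
  assumes m: "f \<in> borel_measurable M"
    and "pos_integral M f < \<infinity>" "neg_integral M f < \<infinity>"
  shows "AE x in M. f x = ereal (real_of_ereal (f x))"
    and "integrable M (\<lambda>x. real_of_ereal (f x))"
    and "ereal_integral M f = ereal (\<integral>x. real_of_ereal (f x) \<partial>M)"
proof -
  note [measurable] = m
  have "AE x in M. e2ennreal (f x) \<noteq> \<infinity>" "AE x in M. e2ennreal (- f x) \<noteq> \<infinity>"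
    using assms(2,3) unfolding pos_integral_def neg_integral_def
    by (intro nn_integral_PInf_AE; simp)+
  then show fin: "AE x in M. f x = ereal (real_of_ereal (f x))"
  proof eventually_elim
    case (elim x)
    then show ?case by (cases "f x") auto
  qed
  have pos: "pos_integral M f = (\<integral>\<^sup>+x. ennreal (real_of_ereal (f x)) \<partial>M)"
    unfolding pos_integral_def
    by (rule nn_integral_cong_AE, use fin in eventually_elim) (metis ennreal.rep_eq e2ennreal_ereal)
  have neg: "neg_integral M f = (\<integral>\<^sup>+x. ennreal (- real_of_ereal (f x)) \<partial>M)"
    unfolding neg_integral_def
    by (rule nn_integral_cong_AE, use fin in eventually_elim)
      (metis e2ennreal_ereal uminus_ereal.simps(1))
  show int: "integrable M (\<lambda>x. real_of_ereal (f x))"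
    using assms(2,3) unfolding real_integrable_def pos neg by auto
  have E: "enn2ereal P = ereal (enn2real P)" if "P < \<infinity>" for P
    using that by (cases P) auto
  show "ereal_integral M f = ereal (\<integral>x. real_of_ereal (f x) \<partial>M)"
    unfolding ereal_integral_def E[OF assms(2)] E[OF assms(3)]
    by (simp add: real_lebesgue_integral_def[OF int] pos neg)
qed

lemma (in prob_space) jensen_exp_minus:
  fixes s :: "'a \<Rightarrow> real"
  assumes "integrable M s" "integrable M (\<lambda>x. exp (- s x))"
  shows "- ln (expectation (\<lambda>x. exp (- s x))) \<le> expectation s"
proof -
  define c where "c = expectation (\<lambda>x. exp (- s x))"
  \<comment> \<open>A strictly positive function with integral 0 would vanish almost everywhere,
    impossible on a space of mass 1.\<close>
  have "c \<noteq> 0"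
    unfolding c_def using integral_nonneg_eq_0_iff_AE[OF assms(2)] AE_False by simp
  moreover have "c \<ge> 0"
    unfolding c_def by (intro integral_nonneg_AE) simp
  ultimately have c: "c > 0" by simp
  \<comment> \<open>Dividing by \<open>c\<close> gives the right side expectation 1, which cancels
    the 1 on the left and leaves the claim.\<close>
  have "expectation (\<lambda>x. 1 - s x - ln c) \<le> expectation (\<lambda>x. exp (- s x) / c)"
  proof (intro integral_mono)
    fix x
    have "exp (- s x) / c = exp (- s x - ln c)"
      using c by (simp add: exp_diff)
    then show "1 - s x - ln c \<le> exp (- s x) / c"
      using exp_ge_add_one_self[of "- s x - ln c"] by linarith
  qed (use assms in auto)
  then show ?thesis
    using assms c by (simp add: c_def[symmetric] prob_space)
qed

text \<open>The negative part of \<open>\<sigma>\<close> is dominated by a function with integral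
  \<open>c\<close>, so the extended integral is meaningful. If the positive part has infinite
  integral, the bound is trivial; otherwise \<open>\<sigma>\<close> is almost everywhere real and
  the real inequality applies.\<close>

lemma (in prob_space) ereal_integral_ge_minus_ln:
  assumes m: "\<sigma> \<in> borel_measurable M"
    and "(\<integral>\<^sup>+x. exp_ereal (- \<sigma> x) \<partial>M) = ennreal c" "0 \<le> c"
  shows "neg_integral M \<sigma> < \<infinity>" and "- ln_ereal c \<le> ereal_integral M \<sigma>"
proof -
  note [measurable] = m
  have "neg_integral M \<sigma> \<le> ennreal c"
    unfolding neg_integral_def assms(2)[symmetric]
    by (intro nn_integral_mono e2ennreal_le_exp_ereal)
  then show neg: "neg_integral M \<sigma> < \<infinity>"
    by (simp add: le_less_trans)
  show "- ln_ereal c \<le> ereal_integral M \<sigma>"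
  proof (cases "pos_integral M \<sigma> = \<infinity>")
    case True
    then show ?thesis
      using neg unfolding ereal_integral_def by (cases "neg_integral M \<sigma>") auto
  next
    case False
    then have "pos_integral M \<sigma> < \<infinity>" by (simp add: top.not_eq_extremum)
    note R = ereal_integral_eq_integral[OF m this neg]
    define s where "s x = real_of_ereal (\<sigma> x)" for x
    have "AE x in M. exp_ereal (- \<sigma> x) = ennreal (exp (- s x))"
      using R(1)
    proof eventually_elim
      case (elim x)
      then show ?case unfolding s_def by (cases "\<sigma> x") (auto simp: exp_ereal_def)
    qed
    then have nn: "(\<integral>\<^sup>+x. ennreal (exp (- s x)) \<partial>M) = ennreal c"
      unfolding assms(2)[symmetric] by (intro nn_integral_cong_AE) auto
    have [measurable]: "s \<in> borel_measurable M"
      unfolding s_def by measurable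
    have int: "integrable M (\<lambda>x. exp (- s x))"
      by (rule integrableI_nn_integral_finite[OF _ _ nn]) (use assms in auto)
    have c: "expectation (\<lambda>x. exp (- s x)) = c"
      using nn assms(3) by (intro integral_eq_nn_integral[THEN trans]) auto
    \<comment> \<open>With \<open>\<sigma>\<close> finite almost everywhere the exponential is
      positive there. Hence the convention for the logarithm of 0 concerns only the case of an
      infinite integral, and \<open>ln_ereal c\<close> is the real logarithm here.\<close>
    have "c \<noteq> 0"
      using c integral_nonneg_eq_0_iff_AE[OF int] AE_False by simp
    then show ?thesis
      using jensen_exp_minus[of s] int R(2) unfolding R(3) c by (simp add: ln_ereal_def s_def[abs_def])
  qed
qed

theorem mainTheorem2:
  fixes M Mr Mac Msc Md :: "'a measure" and \<sigma> :: "'a \<Rightarrow> ereal" and lambda_sc lambda_d :: real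
  assumes "prob_space M" and "prob_space Mr" and "sets Mr = sets M"
    and "\<forall>\<omega> \<in> space M. {\<omega>} \<in> sets M"
    and "continuous_measure M"
    and "lebesgue_decomposition M Mr Mac Msc Md"
    and "entropy_production M Mac \<sigma>"
    and "lambda_sc = measure Msc (space Msc)" and "lambda_d = measure Md (space Md)"
  shows "(\<forall>F :: 'a \<Rightarrow> real. integrable Mr F \<longrightarrow>
            integrable M (\<lambda>\<omega>. F \<omega> * enn2real (exp_ereal (- \<sigma> \<omega>))) \<and>
            integrable Msc F \<and> integrable Md F \<and>
            (\<integral>\<omega>. F \<omega> * enn2real (exp_ereal (- \<sigma> \<omega>)) \<partial>M)
              = (\<integral>\<omega>. F \<omega> \<partial>Mr) - (\<integral>\<omega>. F \<omega> \<partial>Msc) - (\<integral>\<omega>. F \<omega> \<partial>Md))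
         \<and> integrable M (\<lambda>\<omega>. enn2real (exp_ereal (- \<sigma> \<omega>)))
         \<and> (\<integral>\<omega>. enn2real (exp_ereal (- \<sigma> \<omega>)) \<partial>M) = 1 - lambda_sc - lambda_d
         \<and> neg_integral M \<sigma> < \<infinity>
         \<and> ereal_integral M \<sigma> \<ge> - ln_ereal (1 - lambda_sc - lambda_d)"
proof -
  interpret M: prob_space M by fact
  interpret Mr: prob_space Mr by fact
  note [measurable_cong] = \<open>sets Mr = sets M\<close>
  have sets: "sets Mac = sets Mr" "sets Msc = sets Mr" "sets Md = sets Mr"
    and sum: "\<forall>A \<in> sets Mr.
      emeasure Mr A = emeasure Mac A + emeasure Msc A + emeasure Md A"
    and ac: "absolutely_continuous M Mac"
    using assms(3,6) unfolding lebesgue_decomposition_def by auto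
  have \<sigma> [measurable]: "\<sigma> \<in> borel_measurable M"
    and minf: "AE \<omega> in M. \<sigma> \<omega> \<noteq> -\<infinity>"
    and RN: "AE \<omega> in M. exp_ereal (- \<sigma> \<omega>) = RN_deriv M Mac \<omega>"
    using assms(7) unfolding entropy_production_def by auto
  \<comment> \<open>The real-valued density. \<open>enn2real\<close> would turn an infinite value
    into 0, but that value occurs only where \<open>\<sigma>\<close> is \<open>-\<infinity>\<close>,
    a null set.\<close>
  define D where "D \<omega> = enn2real (exp_ereal (- \<sigma> \<omega>))" for \<omega>
  have D [measurable]: "D \<in> borel_measurable M"
    unfolding D_def by measurable
  have D_eq: "AE \<omega> in M. ennreal (D \<omega>) = exp_ereal (- \<sigma> \<omega>)"
    using minf
  proof eventually_elim
    case (elim \<omega>)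
    then show ?case unfolding D_def by (cases "\<sigma> \<omega>") (auto simp: exp_ereal_def)
  qed
  \<comment> \<open>By the Radon-Nikodym theorem \<open>Mac\<close> is recovered from its
    derivative, so integrating \<open>F\<close> against \<open>Mac\<close> amounts to integrating
    \<open>F * D\<close> against \<open>M\<close>.\<close>
  have "density M D = density M (RN_deriv M Mac)"
    using D_eq RN by (intro density_cong) auto
  also have "\<dots> = Mac"
    using ac sets assms(3) by (intro M.density_RN_deriv) auto
  finally have Mac: "Mac = density M D" by simp
  have F: "integrable M (\<lambda>\<omega>. F \<omega> * D \<omega>)" "integrable Msc F" "integrable Md F"
    "(\<integral>\<omega>. F \<omega> * D \<omega> \<partial>M) = integral\<^sup>L Mr F - integral\<^sup>L Msc F - integral\<^sup>L Md F"
    if "integrable Mr F" for F :: "'a \<Rightarrow> real"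
  proof -
    note I = integral_measure_add3[OF sets sum that]
    have [measurable]: "F \<in> borel_measurable M"
      using borel_measurable_integrable[OF that] by simp
    have nonneg: "AE \<omega> in M. 0 \<le> D \<omega>"
      by (simp add: D_def)
    show "integrable M (\<lambda>\<omega>. F \<omega> * D \<omega>)"
      using I(1) nonneg unfolding Mac by (subst (asm) integrable_real_density) (auto simp: mult.commute)
    have "integral\<^sup>L Mac F = (\<integral>\<omega>. F \<omega> * D \<omega> \<partial>M)"
      using nonneg unfolding Mac by (subst integral_real_density) (auto simp: mult.commute)
    then show "(\<integral>\<omega>. F \<omega> * D \<omega> \<partial>M) = integral\<^sup>L Mr F - integral\<^sup>L Msc F - integral\<^sup>L Md F"
      using I(4) by simp
  qed (use integral_measure_add3[OF sets sum that] in auto)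
  \<comment> \<open>The case \<open>F = 1\<close>, where the integral against \<open>Mr\<close> is 1
    and the other two are the masses \<open>lambda_sc\<close> and \<open>lambda_d\<close>.\<close>
  have one: "integrable M D" "integral\<^sup>L M D = 1 - lambda_sc - lambda_d"
    using F(1,4)[of "\<lambda>_. 1"] assms(8,9) by (simp_all add: Mr.prob_space)
  have "(\<integral>\<^sup>+\<omega>. exp_ereal (- \<sigma> \<omega>) \<partial>M) = (\<integral>\<^sup>+\<omega>. ennreal (D \<omega>) \<partial>M)"
    using D_eq by (intro nn_integral_cong_AE) auto
  also have "\<dots> = ennreal (1 - lambda_sc - lambda_d)"
    using one by (subst nn_integral_eq_integral) (auto simp: D_def)
  finally have nn: "(\<integral>\<^sup>+\<omega>. exp_ereal (- \<sigma> \<omega>) \<partial>M) = ennreal (1 - lambda_sc - lambda_d)" .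
  \<comment> \<open>The number is the integral of the nonnegative \<open>D\<close>. Its sign
    guarantees that \<open>ennreal\<close> in \<open>nn\<close> does not truncate it.\<close>
  have "0 \<le> 1 - lambda_sc - lambda_d"
    unfolding one(2)[symmetric] by (intro integral_nonneg_AE) (simp add: D_def)
  note J = M.ereal_integral_ge_minus_ln[OF \<sigma> nn this]
  show ?thesis
    using F one J unfolding D_def by blast
qed

end
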